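(* Let $(K,L,q,1,X,\cdot,h,\theta)$ be a quadrangular algebra over a field $K$ with $\operatorname{char}(K)\neq2,3$, and for $x,y,z\in X$ let $$xyz:=\tfrac12\bigl(x(h(y,z)+h(z,y))+y(h(x,z)+h(z,x))+z(h(x,y)+h(y,x))\bigr)\in X.$$ Then for all $x,y,z\in X$ and $v\in L\setminus\{0\}$, $$(xyz)v=\frac{(xv)(yv)(zv)}{q(v)},$$ where $(xv)(yv)(zv)$ is the triple product of $xv,yv,zv\in X$.
   Context: **Quadrangular algebras.** A quadrangular algebra of characteristic different from 2 is an 8-tuple $(K,L,q,1,X,\cdot,h,\theta)$ where $K$ is a commutative field with $\operatorname{char}K\ne2$, $L$ is a $K$-vector space, $q:L\to K$ is an anisotropic quadratic form, $1\in L$ satisfies $q(1)=1$, $X$ is a nonzero $K$-vector space, $\cdot:X\times L\to X$, $(a,v)\mapsto av$, $h:X\times X\to L$ and $\theta:X\times L\to L$ are maps such that, with $f(u,v)=q(u+v)-q(u)-q(v)$, $v^\sigma=f(1,v)1-v$, $v^{-1}=v^\sigma/q(v)$ for $v\neq 0$: (A1) $\cdot$ is $K$-bilinear; (A2) $a\cdot1=a$; (A3) $(av)v^{-1}=a$ for $v\ne0$; (B1) $h$ is $K$-bilinear; (B2) $h(a,bv)=h(b,av)+f(h(a,b),1)v$; (B3) $f(h(av,b),1)=f(h(a,b),v)$; (C) $\theta(a,v)=\frac12h(a,av)$; (D1) with $\pi(a):=\theta(a,1)$, $a\theta(a,v)=(a\pi(a))v$; (D2) $\pi(a)\in K1$ if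 and only if $a=0$; for all $a,b\in X$, $v\in L$. *)

theory Defs
  imports Complex_Main
begin

definition bilinear_map ::
  "('k::field \<Rightarrow> 'a::ab_group_add \<Rightarrow> 'a) \<Rightarrow> ('k \<Rightarrow> 'b::ab_group_add \<Rightarrow> 'b) \<Rightarrow>
   ('k \<Rightarrow> 'c::ab_group_add \<Rightarrow> 'c) \<Rightarrow> ('a \<Rightarrow> 'b \<Rightarrow> 'c) \<Rightarrow> bool"
  where "bilinear_map s1 s2 s3 b \<longleftrightarrow>
    (\<forall>x. Vector_Spaces.linear s2 s3 (b x)) \<and> (\<forall>y. Vector_Spaces.linear s1 s3 (\<lambda>x. b x y))"

definition polar :: "('l::ab_group_add \<Rightarrow> 'k::field) \<Rightarrow> 'l \<Rightarrow> 'l \<Rightarrow> 'k"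
  where "polar q u v = q (u + v) - q u - q v"

locale quadratic_form = vector_space scale
  for scale :: "'k::field \<Rightarrow> 'l::ab_group_add \<Rightarrow> 'l" +
  fixes q :: "'l \<Rightarrow> 'k"
  assumes q_scale: "q (scale t v) = t\<^sup>2 * q v"
    and polar_bilinear: "bilinear_map scale scale (*) (polar q)"

locale anisotropic_quadratic_form = quadratic_form +
  assumes anisotropic: "q v = 0 \<Longrightarrow> v = 0"

definition qconj ::
  "('k::field \<Rightarrow> 'l::ab_group_add \<Rightarrow> 'l) \<Rightarrow> ('l \<Rightarrow> 'k) \<Rightarrow> 'l \<Rightarrow> 'l \<Rightarrow> 'l"
  where "qconj scale q e v = scale (polar q e v) e - v"

definition qinv ::
  "('k::field \<Rightarrow> 'l::ab_group_add \<Rightarrow> 'l) \<Rightarrow> ('l \<Rightarrow> 'k) \<Rightarrow> 'l \<Rightarrow> 'l \<Rightarrow> 'l"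
  where "qinv scale q e v = scale (1 / q v) (qconj scale q e v)"

(* The field K and the vector spaces L and X are the types 'k, 'l and 'x;
   the distinguished element 1 of L is called e.  In D1 and D2, \<theta> a e is pi(a). *)
locale quadrangular_algebra =
  L: anisotropic_quadratic_form scaleL q + X: vector_space scaleX
  for scaleL :: "'k::field \<Rightarrow> 'l::ab_group_add \<Rightarrow> 'l"
    and q :: "'l \<Rightarrow> 'k"
    and scaleX :: "'k \<Rightarrow> 'x::ab_group_add \<Rightarrow> 'x" +
  fixes e :: 'l
    and act :: "'x \<Rightarrow> 'l \<Rightarrow> 'x" (infixl \<open>\<cdot>\<close> 75)
    and h :: "'x \<Rightarrow> 'x \<Rightarrow> 'l"
    and \<theta> :: "'x \<Rightarrow> 'l \<Rightarrow> 'l"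
  assumes char_not_2: "CHAR('k) \<noteq> 2"
    and q_e: "q e = 1"
    and X_nonzero: "\<exists>a::'x. a \<noteq> 0"
    and A1: "bilinear_map scaleX scaleL scaleX (\<cdot>)"
    and A2: "a \<cdot> e = a"
    and A3: "v \<noteq> 0 \<Longrightarrow> a \<cdot> v \<cdot> qinv scaleL q e v = a"
    and B1: "bilinear_map scaleX scaleX scaleL h"
    and B2: "h a (b \<cdot> v) = h b (a \<cdot> v) + scaleL (polar q (h a b) e) v"
    and B3: "polar q (h (a \<cdot> v) b) e = polar q (h a b) v"
    and C: "\<theta> a v = scaleL (1 / 2) (h a (a \<cdot> v))"
    and D1: "a \<cdot> \<theta> a v = a \<cdot> \<theta> a e \<cdot> v"
    and D2: "(\<exists>t. \<theta> a e = scaleL t e) \<longleftrightarrow> a = 0"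

definition triple_product ::
  "('k::field \<Rightarrow> 'x::ab_group_add \<Rightarrow> 'x) \<Rightarrow> ('x \<Rightarrow> 'l::ab_group_add \<Rightarrow> 'x) \<Rightarrow>
   ('x \<Rightarrow> 'x \<Rightarrow> 'l) \<Rightarrow> 'x \<Rightarrow> 'x \<Rightarrow> 'x \<Rightarrow> 'x"
  where "triple_product scaleX act h x y z =
    scaleX (1 / 2) (act x (h y z + h z y) + act y (h x z + h z x) + act z (h x y + h y x))"

end

theory Submission
  imports Defs
begin

text \<open>
  Juxtaposition denotes the action, \<open>1\<close> the element \<open>e\<close> of \<open>L\<close>, \<open>f\<close> the polar form of \<open>q\<close>, and
  \<open>\<pi>(a) = \<theta>(a,1)\<close>.  Let \<open>\<kappa>(a) = a\<pi>(a)\<close>, a homogeneous map of degree three on \<open>X\<close>.  Since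
  \<open>\<pi>(a) = h(a,a)/2\<close>, the triple product \<open>xyz\<close> is exactly the full polarization
  \<open>\<kappa>(x+y+z) - \<kappa>(x+y) - \<kappa>(x+z) - \<kappa>(y+z) + \<kappa>(x) + \<kappa>(y) + \<kappa>(z)\<close>, with no factor of 6 to
  divide by.  As \<open>a \<mapsto> av\<close> is additive, the theorem follows once \<open>\<kappa>(av) = q(v) \<kappa>(a)v\<close> is known
  for all \<open>a\<close> and \<open>v\<close>.

  For this last identity, write \<open>\<pi> = \<pi>(a)\<close> and \<open>\<theta> = \<theta>(a,v)\<close>.  Axioms B2 and B3 give
  \<open>\<pi>(av) = f(1,v)\<theta> - q(v)\<pi> + f(\<pi>,v)v\<close>, and each of the three summands acts on \<open>av\<close>.  The
  linearization of A3 allows \<open>(av)w\<close> to be rewritten in terms of \<open>(aw)v\<close>; for \<open>w = \<theta>\<close> axiom D1 then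
  replaces \<open>a\<theta>\<close> by \<open>(a\<pi>)v\<close>.  The remaining scalars are determined by B3 and the skew-hermitian
  symmetry of \<open>h\<close>: \<open>f(1,\<pi>) = 0\<close>, \<open>f(1,\<theta>) = -f(\<pi>,v)\<close> and \<open>f(v,\<theta>) = 0\<close>.  Everything cancels except
  \<open>q(v)(a\<pi>)v\<close>.
\<close>

lemma bilinear_mapD:
  assumes "bilinear_map s1 s2 s3 b"
  shows "b (x + x') y = b x y + b x' y" "b x (y + y') = b x y + b x y'"
    "b (x - x') y = b x y - b x' y" "b x (y - y') = b x y - b x y'"
    "b (s1 c x) y = s3 c (b x y)" "b x (s2 c y) = s3 c (b x y)"
proof -
  interpret l: Vector_Spaces.linear s1 s3 "\<lambda>x. b x y" for y
    using assms by (simp add: bilinear_map_def)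
  interpret r: Vector_Spaces.linear s2 s3 "b x" for x
    using assms by (simp add: bilinear_map_def)
  show "b (x + x') y = b x y + b x' y" "b x (y + y') = b x y + b x y'"
    "b (x - x') y = b x y - b x' y" "b x (y - y') = b x y - b x y'"
    "b (s1 c x) y = s3 c (b x y)" "b x (s2 c y) = s3 c (b x y)"
    by (fact l.add r.add l.diff r.diff l.scale r.scale)+
qed

lemma polar_commute: "polar q u v = polar q v u"
  by (simp add: polar_def add.commute)

context quadrangular_algebra
begin

lemmas act_linear = bilinear_mapD[OF A1]
lemmas h_linear = bilinear_mapD[OF B1]
lemmas polar_linear = bilinear_mapD[OF L.polar_bilinear]

lemma two_nonzero: "(2::'k) \<noteq> 0"
proof
  assume "(2::'k) = 0"
  then have "CHAR('k) dvd 2"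
    by (metis of_nat_eq_0_iff_char_dvd of_nat_numeral)
  then have "CHAR('k) \<le> 2" "CHAR('k) \<noteq> 0"
    by (auto dest: dvd_imp_le intro: gr0I)
  moreover have "CHAR('k) \<noteq> 1"
    by simp
  ultimately show False
    using char_not_2 by linarith
qed

lemma q_zero: "q 0 = 0"
  using L.q_scale[of 0 0] by simp

lemma act_act_same: "a \<cdot> v \<cdot> v = scaleX (polar q e v) (a \<cdot> v) - scaleX (q v) a"
proof (cases "v = 0")
  case True
  then show ?thesis
    using act_linear(4)[of _ v v] by (simp add: q_zero)
next
  case False
  then have "q v \<noteq> 0"
    using L.anisotropic by blast
  have "scaleX (q v) a = scaleX (q v) (a \<cdot> v \<cdot> qinv scaleL q e v)"
    using A3[OF False] by simp
  also have "\<dots> = scaleX (polar q e v) (a \<cdot> v) - a \<cdot> v \<cdot> v"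
    using \<open>q v \<noteq> 0\<close> by (simp add: qinv_def qconj_def act_linear A2)
  finally show ?thesis
    by (simp add: algebra_simps)
qed

text \<open>
  The linearization of the preceding identity, which is A3 with denominators cleared; it holds for
  all \<open>v\<close> and \<open>w\<close>, zero included.
\<close>

lemma act_act_swap:
  "a \<cdot> v \<cdot> w = scaleX (polar q e w) (a \<cdot> v) + scaleX (polar q e v) (a \<cdot> w)
     - scaleX (polar q v w) a - a \<cdot> w \<cdot> v"
proof -
  have q: "q (v + w) = polar q v w + q v + q w"
    by (simp add: polar_def)
  have "a \<cdot> v \<cdot> w = a \<cdot> (v + w) \<cdot> (v + w) - a \<cdot> v \<cdot> v - a \<cdot> w \<cdot> w - a \<cdot> w \<cdot> v"
    by (simp add: act_linear)
  also have "\<dots> = scaleX (polar q e w) (a \<cdot> v) + scaleX (polar q e v) (a \<cdot> w)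
     - scaleX (polar q v w) a - a \<cdot> w \<cdot> v"
    unfolding act_act_same[of a] q
    by (simp add: act_linear(2) polar_linear(2) X.scale_left_distrib X.scale_right_distrib)
  finally show ?thesis .
qed

text \<open>The form \<open>h\<close> is skew-hermitian: \<open>h(b,a) = - h(a,b)\<^sup>\<sigma>\<close>.  This is B2 with \<open>v = 1\<close>.\<close>

lemma h_swap: "h b a = h a b - scaleL (polar q (h a b) e) e"
  using B2[of a b e] by (simp add: A2 eq_diff_eq)

lemma trace_h_swap: "polar q (h b a) e = - polar q (h a b) e"
proof -
  have "e + e = scaleL 2 e"
    by (metis L.scale_left_distrib L.scale_one one_add_one)
  then have "polar q e e = 2"
    by (simp add: polar_def q_e L.q_scale)
  then show ?thesis
    by (subst h_swap) (simp add: polar_linear)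
qed

lemma trace_h_same: "polar q (h a a) e = 0"
  using trace_h_swap[of a a] two_nonzero
  by (metis eq_neg_iff_add_eq_0 mult_2 mult_eq_0_iff)

lemma \<pi>_conv_h: "\<theta> a e = scaleL (1 / 2) (h a a)"
  by (simp add: C A2)

lemma polar_e_\<pi>: "polar q e (\<theta> a e) = 0"
  using trace_h_same[of a] by (simp add: \<pi>_conv_h polar_linear polar_commute[of q e])

lemma polar_e_\<theta>: "polar q e (\<theta> a v) = - polar q (\<theta> a e) v"
  using trace_h_swap[of a "a \<cdot> v"]
  by (simp add: C A2 B3 polar_linear polar_commute[of q e])

lemma polar_\<theta>_self: "polar q v (\<theta> a v) = 0"
  using B3[of a v "a \<cdot> v"]
  by (simp add: C trace_h_same polar_linear polar_commute[of q v])

lemma \<pi>_act: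
  "\<theta> (a \<cdot> v) e = scaleL (polar q e v) (\<theta> a v) - scaleL (q v) (\<theta> a e)
     + scaleL (polar q (\<theta> a e) v) v"
  using B2[of "a \<cdot> v" a v]
  by (simp add: C A2 B3 act_act_same h_linear polar_linear L.scale_right_distrib
      L.scale_right_diff_distrib mult.commute)

text \<open>The key identity \<open>\<kappa>(av) = q(v) \<kappa>(a)v\<close> for the cube map \<open>\<kappa>(a) = a\<pi>(a)\<close>.\<close>

lemma cube_act: "a \<cdot> v \<cdot> \<theta> (a \<cdot> v) e = scaleX (q v) (a \<cdot> \<theta> a e \<cdot> v)"
proof -
  let ?\<pi> = "\<theta> a e" and ?\<theta> = "\<theta> a v"
  have \<theta>: "a \<cdot> v \<cdot> ?\<theta> = scaleX (q v) (a \<cdot> ?\<pi>) - scaleX (polar q ?\<pi> v) (a \<cdot> v)"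
    unfolding act_act_swap[of a v ?\<theta>] D1[of a v] act_act_same[of "a \<cdot> ?\<pi>"]
    by (simp add: polar_e_\<theta> polar_\<theta>_self)
  have \<pi>: "a \<cdot> v \<cdot> ?\<pi> = scaleX (polar q e v) (a \<cdot> ?\<pi>) - scaleX (polar q ?\<pi> v) a - a \<cdot> ?\<pi> \<cdot> v"
    unfolding act_act_swap[of a v ?\<pi>] by (simp add: polar_e_\<pi> polar_commute[of q v])
  show ?thesis
    by (simp add: \<pi>_act act_linear \<theta> \<pi> act_act_same[of a v] X.scale_right_diff_distrib
        mult.commute)
qed

lemma triple_product_conv_cube:
  "triple_product scaleX (\<cdot>) h x y z =
     (x + y + z) \<cdot> \<theta> (x + y + z) e
     - (x + y) \<cdot> \<theta> (x + y) e - (x + z) \<cdot> \<theta> (x + z) e - (y + z) \<cdot> \<theta> (y + z) e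
     + x \<cdot> \<theta> x e + y \<cdot> \<theta> y e + z \<cdot> \<theta> z e"
  by (simp add: triple_product_def \<pi>_conv_h act_linear h_linear X.scale_right_distrib algebra_simps)

lemma triple_product_act:
  "triple_product scaleX (\<cdot>) h (x \<cdot> v) (y \<cdot> v) (z \<cdot> v) =
     scaleX (q v) (triple_product scaleX (\<cdot>) h x y z \<cdot> v)"
  unfolding triple_product_conv_cube act_linear(1)[symmetric] cube_act
  by (simp only: act_linear X.scale_right_distrib X.scale_right_diff_distrib)

end

theorem theorem4p3:
  fixes scaleL :: "'k::field \<Rightarrow> 'l::ab_group_add \<Rightarrow> 'l"
    and scaleX :: "'k \<Rightarrow> 'x::ab_group_add \<Rightarrow> 'x"
    and q :: "'l \<Rightarrow> 'k"
    and e :: 'l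
    and act :: "'x \<Rightarrow> 'l \<Rightarrow> 'x" (infixl \<open>\<cdot>\<close> 75)
    and h :: "'x \<Rightarrow> 'x \<Rightarrow> 'l"
    and \<theta> :: "'x \<Rightarrow> 'l \<Rightarrow> 'l"
    and x y z :: 'x
    and v :: 'l
  assumes "quadrangular_algebra scaleL q scaleX e (\<cdot>) h \<theta>"
    and "CHAR('k) \<noteq> 2" and "CHAR('k) \<noteq> 3"
    and "v \<noteq> 0"
  shows "triple_product scaleX (\<cdot>) h x y z \<cdot> v =
    scaleX (1 / q v) (triple_product scaleX (\<cdot>) h (x \<cdot> v) (y \<cdot> v) (z \<cdot> v))"
proof -
  interpret quadrangular_algebra scaleL q scaleX e "(\<cdot>)" h \<theta>
    by fact
  have "q v \<noteq> 0"
    using \<open>v \<noteq> 0\<close> L.anisotropic by blast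
  then show ?thesis
    by (simp add: triple_product_act)
qed

end
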